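(* Let $\mathcal{H}$ be a real Hilbert space. Let $A,B\colon\mathcal{H}\rightrightarrows\mathcal{H}$ be maximally $\alpha_A$-monotone and maximally $\alpha_B$-monotone, respectively, where $\alpha_A,\alpha_B\in\mathbb{R}$. Let $\theta,\sigma_A,\sigma_B>0$ be such that $\theta\alpha_A+\sigma_A>0$ and $\theta\alpha_B+\sigma_B>0$, let $\gamma>0$, let $\lambda\in\left]0,2\right]$ and let $q\in\operatorname{ran}\left(\mathrm{Id}+\frac{\theta}{\sigma_A+\sigma_B}(A+B)\right)$. Given any arbitrary $x_0\in\mathcal{H}$, consider the sequences generated, for $k\in\mathbb{N}$, by $$\left\{\begin{aligned} u_k&=J_{\frac{\gamma\theta}{1+\gamma\sigma_A}A}\left(\frac{1}{1+\gamma\sigma_A}(x_k+\gamma\sigma_Aq)\right)\\ v_k&=J_{\frac{\gamma\theta}{1+\gamma\sigma_B}B}\left(\frac{1}{1+\gamma\sigma_B}(2u_k-x_k+\gamma\sigma_Bq)\right)\\ x_{k+1}&=x_k+\lambda(v_k-u_k).\end{aligned}\right.$$ Then $u_k\to J_{\frac{\theta}{\sigma_A+\sigma_B}(A+B)}(q)$ in norm, and $(x_k)$ converges weakly to some $x\in\mathcal{H}$ with $$J_{\frac{\gamma\theta}{1+\gamma\sigma_A}A}\left(\frac{1}{1+\gamma\sigma_A}(x+\gamma\sigma_Aq)\right)=J_{\frac{\theta}{\sigma_A+\sigma_B}(A+B)}(q).$$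
   Context: For $\alpha\in\mathbb{R}$, a set-valued operator $A\colon\mathcal{H}\rightrightarrows\mathcal{H}$ is $\alpha$-monotone if $\langle x-y,u-v\rangle\ge\alpha\|x-y\|^2$ for all $(x,u),(y,v)$ in its graph, and maximally $\alpha$-monotone if moreover no $\alpha$-monotone operator has a graph properly containing that of $A$. $\operatorname{ran}A=\{u:\exists x,\ u\in A(x)\}$. The resolvent of $A$ with parameter $\gamma>0$ is $J_{\gamma A}:=(\mathrm{Id}+\gamma A)^{-1}$ (a singleton $\{u\}$ is identified with $u$). Sums of set-valued operators are pointwise Minkowski sums. *)

theory Defs
  imports "HOL-Analysis.Analysis" "HOL-Library.Set_Algebras"
begin

type_synonym 'a operator = "'a \<Rightarrow> 'a set"

definition op_graph :: "'a operator \<Rightarrow> ('a \<times> 'a) set"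
  where "op_graph A = {(x, u). u \<in> A x}"

definition op_ran :: "'a operator \<Rightarrow> 'a set"
  where "op_ran A = {u. \<exists>x. u \<in> A x}"

definition op_inverse :: "'a operator \<Rightarrow> 'a operator"
  where "op_inverse A = (\<lambda>u. {x. u \<in> A x})"

definition op_Id :: "'a operator"
  where "op_Id = (\<lambda>x. {x})"

text \<open>The sum on the right-hand side is the Minkowski sum of sets.\<close>

definition op_add :: "'a::real_vector operator \<Rightarrow> 'a operator \<Rightarrow> 'a operator"
  where "op_add A B = (\<lambda>x. A x + B x)"

definition op_scale :: "real \<Rightarrow> 'a::real_vector operator \<Rightarrow> 'a operator"
  where "op_scale c A = (\<lambda>x. (\<lambda>u. c *\<^sub>R u) ` A x)"

definition monotone_mod :: "real \<Rightarrow> 'a::real_inner operator \<Rightarrow> bool"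
  where "monotone_mod \<alpha> A \<longleftrightarrow>
    (\<forall>(x, u) \<in> op_graph A. \<forall>(y, v) \<in> op_graph A.
       inner (x - y) (u - v) \<ge> \<alpha> * (norm (x - y))\<^sup>2)"

definition max_monotone_mod :: "real \<Rightarrow> 'a::real_inner operator \<Rightarrow> bool"
  where "max_monotone_mod \<alpha> A \<longleftrightarrow>
    monotone_mod \<alpha> A \<and> \<not> (\<exists>B. monotone_mod \<alpha> B \<and> op_graph A \<subset> op_graph B)"

text \<open>\<open>resolvent \<gamma> A\<close> is \<open>J\<^bsub>\<gamma>A\<^esub>\<close>. It is set-valued; where a value is a singleton,
  \<^const>\<open>the_elem\<close> extracts its element.\<close>

definition resolvent :: "real \<Rightarrow> 'a::real_vector operator \<Rightarrow> 'a operator"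
  where "resolvent \<gamma> A = op_inverse (op_add op_Id (op_scale \<gamma> A))"

text \<open>By the Riesz representation theorem, in a Hilbert space the functionals
  \<open>\<lambda>x. inner x y\<close> are all the continuous linear ones.\<close>

definition weakly_tendsto :: "(nat \<Rightarrow> 'a::real_inner) \<Rightarrow> 'a \<Rightarrow> bool"
  where "weakly_tendsto x l \<longleftrightarrow> (\<forall>y. (\<lambda>k. inner (x k) y) \<longlonglongrightarrow> inner l y)"

end

theory Submission
  imports Defs
begin

text \<open>Replacing \<open>A\<close> by \<open>A' = \<theta>A + \<sigma>\<^sub>A(Id - q)\<close>, and \<open>B\<close> likewise, turns the iteration into the
  relaxed Douglas-Rachford iteration for two strongly monotone operators, whose sum vanishes exactly
  at \<open>J\<^bsub>\<theta>/(\<sigma>\<^sub>A+\<sigma>\<^sub>B)(A+B)\<^esub>(q)\<close>. Minty's theorem makes the resolvents single-valued.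
  Strong monotonicity gives, for every fixed point \<open>f\<close>, a decrease of \<open>\<parallel>x\<^sub>k - f\<parallel>\<^sup>2\<close> by at least
  a multiple of \<open>\<parallel>u\<^sub>k - p\<parallel>\<^sup>2 + \<parallel>v\<^sub>k - p\<parallel>\<^sup>2\<close>, even for \<open>\<lambda> = 2\<close>. So \<open>u\<^sub>k\<close> and \<open>v\<^sub>k\<close> converge in norm,
  and closedness of the graphs shows that weak limit candidates of \<open>x\<^sub>k\<close> are fixed points.\<close>

section \<open>Minimization by Cauchy minimizing sequences\<close>

lemma parallelogram_midpoint:
  fixes x y :: "'a::real_inner"
  shows "(norm (x - y))\<^sup>2 = 2 * (norm x)\<^sup>2 + 2 * (norm y)\<^sup>2 - 4 * (norm (midpoint x y))\<^sup>2"
  by (simp add: midpoint_def power_divide power2_norm_eq_inner inner_simps inner_commute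
      field_simps)

lemma Cauchy_norm_square_bound:
  fixes z :: "nat \<Rightarrow> 'a::real_normed_vector"
  assumes "\<And>m n. m \<le> n \<Longrightarrow> (norm (z m - z n))\<^sup>2 \<le> e m" and "e \<longlonglongrightarrow> 0"
  shows "Cauchy z"
proof (rule metric_CauchyI)
  fix d :: real
  assume "d > 0"
  then have "\<forall>\<^sub>F m in sequentially. e m < (d/2)\<^sup>2"
    by (intro order_tendstoD(2)[OF assms(2)]) simp
  then obtain M where M: "e M < (d/2)\<^sup>2"
    by (auto simp: eventually_sequentially)
  have close: "dist (z M) (z n) < d/2" if "n \<ge> M" for n
    using assms(1)[OF that] M \<open>d > 0\<close>
    by (metis dist_norm half_gt_zero less_imp_le order_le_less_trans power_less_imp_less_base)
  have "dist (z m) (z n) < d" if "m \<ge> M" "n \<ge> M" for m n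
    using close[OF that(1)] close[OF that(2)] by (metis dist_commute dist_triangle_half_l)
  then show "\<exists>M. \<forall>m\<ge>M. \<forall>n\<ge>M. dist (z m) (z n) < d"
    by blast
qed

text \<open>\<open>K\<close> plays the epigraph of a closed convex function with an affine minorant.
  Adding half the squared norm makes minimizing sequences Cauchy by the parallelogram identity, so
  completeness yields a minimizer without weak compactness.\<close>

lemma strongly_convex_minimizer:
  fixes K :: "('a::{real_inner, complete_space} \<times> real) set"
  assumes "closed K" "convex K" "K \<noteq> {}"
    and lower: "\<And>z t. (z, t) \<in> K \<Longrightarrow> inner a z - c \<le> t"
  obtains z t where "(z, t) \<in> K"
    and "\<And>z' t'. (z', t') \<in> K \<Longrightarrow> t + (norm z)\<^sup>2 / 2 \<le> t' + (norm z')\<^sup>2 / 2"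
proof -
  define \<phi> where "\<phi> = (\<lambda>(z::'a, t::real). t + (norm z)\<^sup>2 / 2)"
  define m where "m = Inf (\<phi> ` K)"
  \<comment> \<open>Completing the square turns the affine minorant plus
    \<open>(norm z)\<^sup>2 / 2\<close> into \<open>(norm (a + z))\<^sup>2 / 2\<close> plus this
    constant.\<close>
  have "- c - (norm a)\<^sup>2 / 2 \<le> \<phi> w" if "w \<in> K" for w
  proof -
    obtain z t where w: "w = (z, t)" by force
    have "0 \<le> (norm (a + z))\<^sup>2" by simp
    then show ?thesis
      using lower[of z t] that unfolding w \<phi>_def
      by (simp add: power2_norm_eq_inner inner_simps inner_commute)
  qed
  then have bdd: "bdd_below (\<phi> ` K)" by (intro bdd_belowI2)
  have m_le: "m \<le> \<phi> w" if "w \<in> K" for w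
    unfolding m_def using bdd that by (simp add: cINF_lower)
  have "\<exists>w\<in>K. \<phi> w < m + inverse (real (Suc n))" for n
    using cInf_lessD[of "\<phi> ` K" "m + inverse (real (Suc n))"] \<open>K \<noteq> {}\<close>
    by (auto simp: m_def)
  then obtain w where w: "\<And>n. w n \<in> K" "\<And>n. \<phi> (w n) < m + inverse (real (Suc n))"
    by metis
  define z where "z n = fst (w n)" for n
  define t where "t n = snd (w n)" for n
  have w_eq: "w n = (z n, t n)" for n by (simp add: z_def t_def)
  have "Cauchy z"
  proof (rule Cauchy_norm_square_bound)
    fix i j :: nat
    assume "i \<le> j"
    have "midpoint (w i) (w j) \<in> K"
      using w(1) \<open>convex K\<close> midpoint_in_closed_segment closed_segment_subset by blast
    moreover have "midpoint (w i) (w j) = (midpoint (z i) (z j), (t i + t j) / 2)"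
      by (simp add: w_eq midpoint_def)
    ultimately have "m \<le> (t i + t j) / 2 + (norm (midpoint (z i) (z j)))\<^sup>2 / 2"
      using m_le by (fastforce simp: \<phi>_def)
    moreover have "t i + (norm (z i))\<^sup>2 / 2 < m + inverse (real (Suc i))"
      "t j + (norm (z j))\<^sup>2 / 2 < m + inverse (real (Suc j))"
      using w(2)[of i] w(2)[of j] by (simp_all add: w_eq \<phi>_def)
    moreover have "inverse (real (Suc j)) \<le> inverse (real (Suc i))"
      using \<open>i \<le> j\<close> by simp
    ultimately show "(norm (z i - z j))\<^sup>2 \<le> 8 * inverse (real (Suc i))"
      unfolding parallelogram_midpoint by argo
  next
    show "(\<lambda>i. 8 * inverse (real (Suc i))) \<longlonglongrightarrow> 0"
      using tendsto_mult_right_zero[OF LIMSEQ_inverse_real_of_nat] by blast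
  qed
  then obtain zl where zl: "z \<longlonglongrightarrow> zl" using Cauchy_convergent convergent_def by blast
  have "(\<lambda>n. \<phi> (w n)) \<longlonglongrightarrow> m"
  proof (rule tendsto_sandwich)
    show "\<forall>\<^sub>F n in sequentially. m \<le> \<phi> (w n)" using m_le w(1) by simp
    show "\<forall>\<^sub>F n in sequentially. \<phi> (w n) \<le> m + inverse (real (Suc n))"
      using w(2) by (simp add: less_imp_le)
    show "(\<lambda>n. m + inverse (real (Suc n))) \<longlonglongrightarrow> m"
      using tendsto_add[OF tendsto_const LIMSEQ_inverse_real_of_nat] by simp
  qed simp
  \<comment> \<open>Nothing so far bounds the heights \<open>t n\<close>; they converge because both
    \<phi> along \<open>w\<close> and the norms of \<open>z\<close> do.\<close>
  then have "(\<lambda>n. \<phi> (w n) - (norm (z n))\<^sup>2 / 2) \<longlonglongrightarrow> m - (norm zl)\<^sup>2 / 2"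
    by (intro tendsto_intros zl) simp_all
  then have "t \<longlonglongrightarrow> m - (norm zl)\<^sup>2 / 2" by (simp add: \<phi>_def w_eq)
  with zl have "w \<longlonglongrightarrow> (zl, m - (norm zl)\<^sup>2 / 2)"
    unfolding w_eq by (intro tendsto_Pair)
  then have "(zl, m - (norm zl)\<^sup>2 / 2) \<in> K"
    using \<open>closed K\<close> w(1) closed_sequentially by blast
  then show thesis
    using that[of zl "m - (norm zl)\<^sup>2 / 2"] m_le by (fastforce simp: \<phi>_def)
qed

text \<open>First-order optimality: compare the minimizer with the point at fraction
  \<open>s\<close> of the segment towards \<open>(z', t')\<close>, divide by \<open>s\<close> and
  let \<open>s\<close> tend to 0. For an epigraph \<open>K\<close> this says that \<open>- z\<close>
  is a subgradient at \<open>z\<close>.\<close>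

lemma strongly_convex_minimizer_variational:
  fixes K :: "('a::{real_inner, complete_space} \<times> real) set"
  assumes "convex K" and zt: "(z, t) \<in> K"
    and min: "\<And>z' t'. (z', t') \<in> K \<Longrightarrow> t + (norm z)\<^sup>2 / 2 \<le> t' + (norm z')\<^sup>2 / 2"
    and zt': "(z', t') \<in> K"
  shows "t + inner z (z - z') \<le> t'"
proof -
  let ?D = "t' - t + inner z (z' - z)"
  let ?N = "(norm (z' - z))\<^sup>2 / 2"
  have "0 \<le> ?D + s * ?N" if s: "0 < s" "s < 1" for s
  proof -
    have "(1 - s) *\<^sub>R (z, t) + s *\<^sub>R (z', t') \<in> K"
      using convexD_alt[OF \<open>convex K\<close> zt zt'] s by simp
    then have "t + (norm z)\<^sup>2 / 2 \<le>
        ((1 - s) * t + s * t') + (norm ((1 - s) *\<^sub>R z + s *\<^sub>R z'))\<^sup>2 / 2"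
      using min by simp
    moreover have "(1 - s) *\<^sub>R z + s *\<^sub>R z' = z + s *\<^sub>R (z' - z)"
      by (simp add: algebra_simps)
    moreover have "(norm (z + s *\<^sub>R (z' - z)))\<^sup>2 =
        (norm z)\<^sup>2 + 2 * s * inner z (z' - z) + s\<^sup>2 * (norm (z' - z))\<^sup>2"
      unfolding power2_norm_eq_inner
      by (simp add: inner_simps inner_commute power2_eq_square algebra_simps)
    ultimately have "0 \<le> s * (?D + s * ?N)"
      by (simp add: power2_eq_square algebra_simps)
    then show ?thesis using s(1) by (simp add: zero_le_mult_iff)
  qed
  then have "\<forall>\<^sub>F s in at_right 0. 0 \<le> ?D + s * ?N"
    by (intro eventually_at_rightI[of 0 1]) (simp_all only: greaterThanLessThan_iff zero_less_one)
  moreover have "((\<lambda>s. ?D + s * ?N) \<longlongrightarrow> ?D + 0 * ?N) (at_right 0)"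
    by (intro tendsto_intros)
  ultimately have "0 \<le> ?D + 0 * ?N"
    using tendsto_lowerbound trivial_limit_at_right_real by blast
  then show ?thesis by (simp add: inner_diff_right)
qed

section \<open>Maximal monotonicity and Minty's theorem\<close>

lemma monotone_modD:
  assumes "monotone_mod \<alpha> A" "u \<in> A x" "v \<in> A y"
  shows "\<alpha> * (norm (x - y))\<^sup>2 \<le> inner (x - y) (u - v)"
  using assms unfolding monotone_mod_def op_graph_def by blast

text \<open>Otherwise adjoining the single pair \<open>(x, u)\<close> to the graph would give a
  strictly larger \<alpha>-monotone operator.\<close>

lemma max_monotone_mod_memI:
  assumes "max_monotone_mod \<alpha> A"
    and rel: "\<And>y v. v \<in> A y \<Longrightarrow> \<alpha> * (norm (x - y))\<^sup>2 \<le> inner (x - y) (u - v)"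
  shows "u \<in> A x"
proof (rule ccontr)
  assume "u \<notin> A x"
  define B where "B = A(x := insert u (A x))"
  have mem: "w \<in> B y \<longleftrightarrow> w \<in> A y \<or> y = x \<and> w = u" for w y
    by (auto simp: B_def)
  have rel': "\<alpha> * (norm (y - x))\<^sup>2 \<le> inner (y - x) (v - u)" if "v \<in> A y" for y v
    using rel[OF that] by (metis inner_minus_left inner_minus_right minus_diff_eq minus_minus norm_minus_commute)
  have "monotone_mod \<alpha> A" using assms(1) by (simp add: max_monotone_mod_def)
  then have "monotone_mod \<alpha> B"
    unfolding monotone_mod_def[of \<alpha> B] op_graph_def
    using rel rel' by (auto simp: mem intro: monotone_modD)
  moreover have "op_graph A \<subset> op_graph B"
    using \<open>u \<notin> A x\<close> by (auto simp: op_graph_def mem)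
  ultimately show False using assms(1) unfolding max_monotone_mod_def by blast
qed

lemma max_monotone_modI:
  assumes "monotone_mod \<alpha> A"
    and "\<And>x u. (\<And>y v. v \<in> A y \<Longrightarrow> \<alpha> * (norm (x - y))\<^sup>2 \<le> inner (x - y) (u - v)) \<Longrightarrow> u \<in> A x"
  shows "max_monotone_mod \<alpha> A"
  unfolding max_monotone_mod_def
proof (intro conjI notI assms(1))
  assume "\<exists>B. monotone_mod \<alpha> B \<and> op_graph A \<subset> op_graph B"
  then obtain B x u where B: "monotone_mod \<alpha> B" "op_graph A \<subset> op_graph B" "u \<in> B x" "u \<notin> A x"
    unfolding op_graph_def by blast
  then have "v \<in> B y" if "v \<in> A y" for y v using that by (auto simp: op_graph_def)
  then show False using assms(2)[of x u] monotone_modD[OF B(1,3)] B(4) by blast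
qed

text \<open>The set \<open>K\<close> is the epigraph of the Fitzpatrick function of \<open>G\<close>, which dominates
  the duality pairing because \<open>G\<close> is maximal.\<close>

lemma Minty:
  fixes A :: "'a::{real_inner, complete_space} operator"
  assumes "max_monotone_mod 0 A"
  obtains x where "- x \<in> A x"
proof -
  define G where "G = op_graph A"
  have mono: "0 \<le> inner (x - y) (u - v)" if "(x, u) \<in> G" "(y, v) \<in> G" for x u y v
    using monotone_modD[of 0 A] assms that by (simp add: G_def op_graph_def max_monotone_mod_def)
  have maximal: "(x, u) \<in> G" if "\<And>y v. (y, v) \<in> G \<Longrightarrow> 0 \<le> inner (x - y) (u - v)" for x u
    using max_monotone_mod_memI[OF assms] that by (simp add: G_def op_graph_def)
  \<comment> \<open>The graph is nonempty: if it were empty, \<open>(0, 0)\<close> would be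
    vacuously related to all of it and hence belong to it.\<close>
  obtain y0 v0 where yv0: "(y0, v0) \<in> G" using maximal[of 0 0] by blast
  define K where "K = (\<Inter>(y, v)\<in>G. {w :: ('a \<times> 'a) \<times> real.
     inner ((v, y), -1) w \<le> inner y v})"
  have K_iff: "((x, u), t) \<in> K \<longleftrightarrow>
      (\<forall>(y, v)\<in>G. inner x v + inner y u - inner y v \<le> t)" for x u t
    by (auto simp: K_def inner_commute algebra_simps)
  have "closed K" "convex K"
    unfolding K_def
    by (auto intro!: closed_INT convex_INT closed_halfspace_le convex_halfspace_le)
  have graph_K: "((y, v), inner y v) \<in> K" if "(y, v) \<in> G" for y v
    using mono[OF that] by (fastforce simp: K_iff inner_diff_left inner_diff_right)
  obtain z t where zt: "(z, t) \<in> K"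
    and min: "\<And>z' t'. (z', t') \<in> K \<Longrightarrow> t + (norm z)\<^sup>2 / 2 \<le> t' + (norm z')\<^sup>2 / 2"
  proof (rule strongly_convex_minimizer)
    show "K \<noteq> {}" using graph_K[OF yv0] by blast
    show "inner (v0, y0) z - inner y0 v0 \<le> t" if "(z, t) \<in> K" for z t
      using that yv0 by (cases z) (fastforce simp: K_iff inner_commute)
  qed (use \<open>closed K\<close> \<open>convex K\<close> in auto)
  obtain x u where z: "z = (x, u)" by force
  \<comment> \<open>If \<open>t\<close> were smaller, membership in \<open>K\<close> would make
    \<open>(x, u)\<close> monotonically related to all of \<open>G\<close>, so a point of
    \<open>G\<close>; the constraint of \<open>K\<close> at that very point then contradicts the
    assumption.\<close>
  have pairing: "inner x u \<le> t"
  proof (rule ccontr)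
    assume "\<not> inner x u \<le> t"
    then have "(x, u) \<in> G"
      using zt by (intro maximal) (fastforce simp: z K_iff inner_diff_left inner_diff_right)
    then show False using zt \<open>\<not> inner x u \<le> t\<close> by (fastforce simp: z K_iff)
  qed
  \<comment> \<open>Graph points lie in \<open>K\<close> at height \<open>inner y v\<close>, so the
    variational inequality applies to them. Replacing \<open>t\<close> by \<open>inner x u\<close>
    completes the square on the left.\<close>
  have key: "(norm (x + u))\<^sup>2 \<le> inner (y + u) (v + x)" if "(y, v) \<in> G" for y v
  proof -
    have "t + inner z (z - (y, v)) \<le> inner y v"
      using strongly_convex_minimizer_variational[OF \<open>convex K\<close> zt min graph_K[OF that]] .
    then show ?thesis
      using pairing unfolding z power2_norm_eq_inner
      by (simp add: inner_diff_right inner_add_left inner_add_right inner_commute)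
  qed
  have "(- u, - x) \<in> G"
  proof (rule maximal)
    fix y v
    assume "(y, v) \<in> G"
    have "0 \<le> (norm (x + u))\<^sup>2" by simp
    also note key[OF \<open>(y, v) \<in> G\<close>]
    also have "inner (y + u) (v + x) = inner (- u - y) (- x - v)"
      by (simp add: inner_diff_left inner_diff_right inner_add_left inner_add_right)
    finally show "0 \<le> inner (- u - y) (- x - v)" .
  qed
  \<comment> \<open>At the graph point \<open>(- u, - x)\<close> itself the right-hand side of
    \<open>key\<close> is 0, which forces \<open>x + u = 0\<close>.\<close>
  moreover from key[OF this] have "- x = - (- u)" by (simp add: minus_unique)
  ultimately show thesis using that[of "- u"] by (simp add: G_def op_graph_def)
qed

lemma monotone_mod_op_add:
  assumes "monotone_mod \<alpha> A" "monotone_mod \<beta> B"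
  shows "monotone_mod (\<alpha> + \<beta>) (op_add A B)"
proof -
  have "(\<alpha> + \<beta>) * (norm (x - y))\<^sup>2 \<le> inner (x - y) ((a + b) - (a' + b'))"
    if "a \<in> A x" "b \<in> B x" "a' \<in> A y" "b' \<in> B y" for x y a b a' b'
    using monotone_modD[OF assms(1) that(1,3)] monotone_modD[OF assms(2) that(2,4)]
    by (simp add: distrib_right inner_diff_right inner_add_right)
  then show ?thesis
    unfolding monotone_mod_def op_graph_def op_add_def set_plus_def by blast
qed

section \<open>Resolvents and affine changes of operators\<close>

lemma mem_resolvent:
  "y \<in> resolvent c A z \<longleftrightarrow> (\<exists>w\<in>A y. z = y + c *\<^sub>R w)"
  by (auto simp: resolvent_def op_inverse_def op_add_def op_Id_def op_scale_def set_plus_def)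

lemma mem_resolvent_iff:
  assumes "c \<noteq> 0"
  shows "y \<in> resolvent c A z \<longleftrightarrow> (1 / c) *\<^sub>R (z - y) \<in> A y"
  using assms by (force simp: mem_resolvent)

lemma resolvent_monotone:
  assumes mono: "monotone_mod \<alpha> A" and "c > 0"
    and y: "y \<in> resolvent c A z" and y': "y' \<in> resolvent c A z'"
  shows "c * \<alpha> * (norm (y - y'))\<^sup>2 \<le> inner (y - y') ((z - y) - (z' - y'))"
proof -
  have "\<alpha> * (norm (y - y'))\<^sup>2 \<le> inner (y - y') ((1 / c) *\<^sub>R (z - y) - (1 / c) *\<^sub>R (z' - y'))"
    using y y' \<open>c > 0\<close> by (intro monotone_modD[OF mono]) (simp_all add: mem_resolvent_iff)
  also have "\<dots> = inner (y - y') ((z - y) - (z' - y')) / c"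
    by (simp flip: scaleR_diff_right)
  finally show ?thesis using \<open>c > 0\<close> by (simp add: pos_le_divide_eq mult.commute mult.left_commute)
qed

text \<open>The condition on \<open>1 + c * \<alpha>\<close> makes \<open>Id + c A\<close> strongly
  monotone, even for negative \<alpha>, so two preimages of \<open>z\<close> coincide.\<close>

lemma resolvent_unique:
  assumes mono: "monotone_mod \<alpha> A" and "c > 0" "1 + c * \<alpha> > 0"
    and "y \<in> resolvent c A z" "y' \<in> resolvent c A z"
  shows "y = y'"
proof -
  have "inner (y - y') ((z - y) - (z - y')) = - (norm (y - y'))\<^sup>2"
    by (simp add: power2_norm_eq_inner inner_diff_left inner_diff_right)
  then have "(1 + c * \<alpha>) * (norm (y - y'))\<^sup>2 \<le> 0"
    using resolvent_monotone[OF mono \<open>c > 0\<close> assms(4,5)] by (simp add: distrib_right)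
  then have "(norm (y - y'))\<^sup>2 \<le> 0"
    using assms(3) by (simp add: mult_le_0_iff)
  then show ?thesis by simp
qed

text \<open>The offset \<open>b\<close> is kept free to serve two purposes:
  \<open>b = - \<sigma> q\<close> gives the operators \<open>A'\<close> and \<open>B'\<close> of the
  reduction, and another choice brings a resolvent equation into the form of
  \<open>Minty\<close>.\<close>

definition op_affine :: "real \<Rightarrow> real \<Rightarrow> 'a::real_vector \<Rightarrow> 'a operator \<Rightarrow> 'a operator"
  where "op_affine \<theta> \<sigma> b A = (\<lambda>y. (\<lambda>w. \<theta> *\<^sub>R w + \<sigma> *\<^sub>R y + b) ` A y)"

lemma mem_op_affine:
  assumes "\<theta> \<noteq> 0"
  shows "s \<in> op_affine \<theta> \<sigma> b A y \<longleftrightarrow> (1 / \<theta>) *\<^sub>R (s - \<sigma> *\<^sub>R y - b) \<in> A y"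
  using assms by (force simp: op_affine_def)

lemma inner_op_affine:
  "inner (x - y) ((\<theta> *\<^sub>R w + \<sigma> *\<^sub>R x + b) - (\<theta> *\<^sub>R v + \<sigma> *\<^sub>R y + b))
    = \<theta> * inner (x - y) (w - v) + \<sigma> * (norm (x - y))\<^sup>2"
proof -
  have "(\<theta> *\<^sub>R w + \<sigma> *\<^sub>R x + b) - (\<theta> *\<^sub>R v + \<sigma> *\<^sub>R y + b)
      = \<theta> *\<^sub>R (w - v) + \<sigma> *\<^sub>R (x - y)"
    by (simp add: algebra_simps)
  then show ?thesis by (simp add: inner_add_right power2_norm_eq_inner)
qed

text \<open>By \<open>inner_op_affine\<close>, the inequality with modulus
  \<open>\<theta> * \<alpha> + \<sigma>\<close> for the new operator is \<theta> times the
  inequality with modulus \<alpha> for \<open>A\<close>. The two are equivalent, so maximality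
  carries over as well.\<close>

lemma max_monotone_mod_op_affine:
  assumes max: "max_monotone_mod \<alpha> A" and "\<theta> > 0"
  shows "max_monotone_mod (\<theta> * \<alpha> + \<sigma>) (op_affine \<theta> \<sigma> b A)"
proof (rule max_monotone_modI)
  have mono: "monotone_mod \<alpha> A" using max by (simp add: max_monotone_mod_def)
  have "(\<theta> * \<alpha> + \<sigma>) * (norm (x - y))\<^sup>2 \<le> inner (x - y) (s - r)"
    if s: "s \<in> op_affine \<theta> \<sigma> b A x" and r: "r \<in> op_affine \<theta> \<sigma> b A y" for x s y r
  proof -
    obtain w v where "w \<in> A x" "v \<in> A y"
      and eq: "s = \<theta> *\<^sub>R w + \<sigma> *\<^sub>R x + b" "r = \<theta> *\<^sub>R v + \<sigma> *\<^sub>R y + b"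
      using s r unfolding op_affine_def by blast
    then have "\<theta> * (\<alpha> * (norm (x - y))\<^sup>2) \<le> \<theta> * inner (x - y) (w - v)"
      using monotone_modD[OF mono] \<open>\<theta> > 0\<close> by simp
    then show ?thesis unfolding eq inner_op_affine by (simp add: distrib_right)
  qed
  then show "monotone_mod (\<theta> * \<alpha> + \<sigma>) (op_affine \<theta> \<sigma> b A)"
    unfolding monotone_mod_def op_graph_def by blast
next
  fix x s
  assume rel: "\<And>y r. r \<in> op_affine \<theta> \<sigma> b A y \<Longrightarrow>
    (\<theta> * \<alpha> + \<sigma>) * (norm (x - y))\<^sup>2 \<le> inner (x - y) (s - r)"
  define w where "w = (1 / \<theta>) *\<^sub>R (s - \<sigma> *\<^sub>R x - b)"
  have s: "s = \<theta> *\<^sub>R w + \<sigma> *\<^sub>R x + b" using \<open>\<theta> > 0\<close> by (simp add: w_def)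
  have "w \<in> A x"
  proof (rule max_monotone_mod_memI[OF max])
    fix y v
    assume "v \<in> A y"
    then have "(\<theta> * \<alpha> + \<sigma>) * (norm (x - y))\<^sup>2 \<le>
        inner (x - y) (s - (\<theta> *\<^sub>R v + \<sigma> *\<^sub>R y + b))"
      unfolding op_affine_def by (intro rel[unfolded op_affine_def]) blast
    then have "\<theta> * (\<alpha> * (norm (x - y))\<^sup>2) \<le> \<theta> * inner (x - y) (w - v)"
      unfolding s inner_op_affine by (simp add: algebra_simps)
    then show "\<alpha> * (norm (x - y))\<^sup>2 \<le> inner (x - y) (w - v)"
      using \<open>\<theta> > 0\<close> by simp
  qed
  then show "s \<in> op_affine \<theta> \<sigma> b A x" unfolding op_affine_def s by blast
qed

lemma resolvent_singleton:
  fixes A :: "'a::{real_inner, complete_space} operator"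
  assumes max: "max_monotone_mod \<alpha> A" and c: "c > 0" "1 + c * \<alpha> > 0"
  obtains y where "resolvent c A z = {y}"
proof -
  \<comment> \<open>The term \<open>- \<kappa> * \<alpha>\<close> brings the modulus down to 0. The
    values of \<kappa> and \<open>z'\<close> are those for which
    \<open>- y = \<kappa> w - \<kappa> \<alpha> y - z'\<close> is equivalent to
    \<open>z = y + c w\<close>.\<close>
  define \<kappa> where "\<kappa> = c / (1 + c * \<alpha>)"
  define z' where "z' = (1 / (1 + c * \<alpha>)) *\<^sub>R z"
  have "\<kappa> > 0" using c by (simp add: \<kappa>_def)
  then have "max_monotone_mod 0 (op_affine \<kappa> (- \<kappa> * \<alpha>) (- z') A)"
    using max_monotone_mod_op_affine[OF max, of \<kappa> "- \<kappa> * \<alpha>"] by simp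
  then obtain y where "- y \<in> op_affine \<kappa> (- \<kappa> * \<alpha>) (- z') A y"
    by (rule Minty)
  then have "(1 / \<kappa>) *\<^sub>R (- y - (- \<kappa> * \<alpha>) *\<^sub>R y - - z') \<in> A y"
    using \<open>\<kappa> > 0\<close> by (simp only: mem_op_affine less_imp_neq[symmetric] simp_thms)
  moreover have "(1 / \<kappa>) *\<^sub>R (- y - (- \<kappa> * \<alpha>) *\<^sub>R y - - z') = (1 / c) *\<^sub>R (z - y)"
  proof -
    have "(1 / \<kappa>) *\<^sub>R z' = (1 / c) *\<^sub>R z" "1 / \<kappa> = 1 / c + \<alpha>"
      using c by (simp_all add: \<kappa>_def z'_def field_simps)
    moreover have "(1 / \<kappa>) *\<^sub>R (- y - (- \<kappa> * \<alpha>) *\<^sub>R y - - z')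
        = (1 / \<kappa>) *\<^sub>R z' + (\<alpha> - 1 / \<kappa>) *\<^sub>R y"
      using \<open>\<kappa> > 0\<close> by (simp add: algebra_simps)
    ultimately show ?thesis by (simp add: algebra_simps)
  qed
  ultimately have "y \<in> resolvent c A z" using c(1) by (simp add: mem_resolvent_iff)
  moreover have "monotone_mod \<alpha> A" using max by (simp add: max_monotone_mod_def)
  ultimately have "resolvent c A z = {y}" using resolvent_unique[OF _ c] by blast
  then show thesis by (rule that)
qed

text \<open>The equation \<open>x = y + \<gamma> (\<theta> w + \<sigma> y - \<sigma> q)\<close>
  reads \<open>x + \<gamma> \<sigma> q = (1 + \<gamma> \<sigma>) y + \<gamma> \<theta> w\<close>;
  dividing by \<open>1 + \<gamma> \<sigma>\<close> produces the parameters of the iteration.\<close>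

lemma resolvent_op_affine:
  assumes "\<theta> > 0" "\<gamma> > 0" "\<sigma> > 0"
  shows "resolvent \<gamma> (op_affine \<theta> \<sigma> (- \<sigma> *\<^sub>R q) A) x =
    resolvent (\<gamma> * \<theta> / (1 + \<gamma> * \<sigma>)) A ((1 / (1 + \<gamma> * \<sigma>)) *\<^sub>R (x + (\<gamma> * \<sigma>) *\<^sub>R q))"
proof -
  define c where "c = 1 + \<gamma> * \<sigma>"
  have "c > 0" using assms by (simp add: c_def add_pos_pos)
  have "(1 / (\<gamma> * \<theta> / c)) *\<^sub>R ((1 / c) *\<^sub>R (x + (\<gamma> * \<sigma>) *\<^sub>R q) - y)
      = (1 / \<theta>) *\<^sub>R ((1 / \<gamma>) *\<^sub>R (x - y) - \<sigma> *\<^sub>R y - - \<sigma> *\<^sub>R q)" for y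
  proof -
    have "(\<gamma> * \<theta>) *\<^sub>R ((1 / (\<gamma> * \<theta> / c)) *\<^sub>R ((1 / c) *\<^sub>R (x + (\<gamma> * \<sigma>) *\<^sub>R q) - y))
        = x + (\<gamma> * \<sigma>) *\<^sub>R q - c *\<^sub>R y"
      using assms \<open>c > 0\<close> by (simp add: scaleR_diff_right)
    also have "\<dots> = (\<gamma> * \<theta>) *\<^sub>R
        ((1 / \<theta>) *\<^sub>R ((1 / \<gamma>) *\<^sub>R (x - y) - \<sigma> *\<^sub>R y - - \<sigma> *\<^sub>R q))"
      using assms by (simp add: c_def algebra_simps)
    finally show ?thesis using assms by (simp only: scaleR_cancel_left) simp
  qed
  then have "y \<in> resolvent \<gamma> (op_affine \<theta> \<sigma> (- \<sigma> *\<^sub>R q) A) x \<longleftrightarrow>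
      y \<in> resolvent (\<gamma> * \<theta> / c) A ((1 / c) *\<^sub>R (x + (\<gamma> * \<sigma>) *\<^sub>R q))" for y
    using assms \<open>c > 0\<close> by (simp only: mem_resolvent_iff mem_op_affine
        mult_eq_0_iff divide_eq_0_iff less_imp_neq[symmetric] simp_thms)
  then show ?thesis unfolding c_def by blast
qed

section \<open>Weak convergence by asymptotic hulls\<close>

text \<open>Stands in for weak compactness. The minimal squared norms \<open>m n\<close> increase to
  a finite limit, and by the parallelogram identity points of almost minimal norm in
  \<open>C n\<close> form a Cauchy sequence; its limit lies in every \<open>C n\<close>.\<close>

lemma nested_convex_Inter_nonempty:
  fixes C :: "nat \<Rightarrow> 'a::{real_inner, complete_space} set"
  assumes closed: "\<And>n. closed (C n)" and convex: "\<And>n. convex (C n)" and ne: "\<And>n. C n \<noteq> {}"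
    and dec: "decseq C" and "bounded (C 0)"
  obtains z where "\<And>n. z \<in> C n"
proof -
  define m where "m n = Inf ((\<lambda>z. (norm z)\<^sup>2) ` C n)" for n
  have sub: "C j \<subseteq> C i" if "i \<le> j" for i j using dec that by (simp add: decseqD)
  have bdd: "bdd_below ((\<lambda>z. (norm z)\<^sup>2) ` C n)" for n by (rule bdd_belowI2[where m = 0]) simp
  have m_le: "m n \<le> (norm z)\<^sup>2" if "z \<in> C n" for n z
    unfolding m_def using bdd that by (rule cINF_lower)
  have "incseq m"
    unfolding m_def by (intro incseq_SucI cINF_superset_mono ne bdd sub) auto
  obtain b where b: "\<And>z. z \<in> C 0 \<Longrightarrow> norm z \<le> b"
    using \<open>bounded (C 0)\<close> by (auto simp: bounded_iff)
  have "m n \<le> b\<^sup>2" for n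
  proof -
    obtain z where "z \<in> C n" using ne by blast
    then show ?thesis using m_le[of z n] b[of z] sub[of 0 n]
      by (meson le0 norm_ge_zero order_trans power_mono subsetD)
  qed
  then obtain L where L: "m \<longlonglongrightarrow> L" "\<And>n. m n \<le> L"
    using incseq_convergent[OF \<open>incseq m\<close>] by blast
  have "\<exists>z\<in>C n. (norm z)\<^sup>2 < m n + inverse (real (Suc n))" for n
    using cInf_lessD[of "(\<lambda>z. (norm z)\<^sup>2) ` C n" "m n + inverse (real (Suc n))"] ne
    by (auto simp: m_def)
  then obtain w where w: "\<And>n. w n \<in> C n" "\<And>n. (norm (w n))\<^sup>2 < m n + inverse (real (Suc n))"
    by metis
  have "Cauchy w"
  proof (rule Cauchy_norm_square_bound)
    fix i j :: nat
    assume "i \<le> j"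
    then have "midpoint (w i) (w j) \<in> C i"
      using w(1) sub convex midpoint_in_closed_segment closed_segment_subset by blast
    then have "m i \<le> (norm (midpoint (w i) (w j)))\<^sup>2" by (rule m_le)
    moreover have "inverse (real (Suc j)) \<le> inverse (real (Suc i))"
      using \<open>i \<le> j\<close> by simp
    ultimately show "(norm (w i - w j))\<^sup>2 \<le> 2 * (L - m i) + 4 * inverse (real (Suc i))"
      unfolding parallelogram_midpoint using w(2)[of i] w(2)[of j] L(2)[of j] by argo
  next
    have "(\<lambda>i. 2 * (L - m i) + 4 * inverse (real (Suc i))) \<longlonglongrightarrow> 2 * (L - L) + 4 * 0"
      by (intro tendsto_intros L LIMSEQ_inverse_real_of_nat)
    then show "(\<lambda>i. 2 * (L - m i) + 4 * inverse (real (Suc i))) \<longlonglongrightarrow> 0" by simp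
  qed
  then obtain z where z: "w \<longlonglongrightarrow> z" using Cauchy_convergent convergent_def by blast
  have "z \<in> C n" for n
  proof (rule closed_sequentially[OF closed])
    show "w (k + n) \<in> C n" for k using w(1)[of "k + n"] sub[of n "k + n"] by auto
    show "(\<lambda>k. w (k + n)) \<longlonglongrightarrow> z" using z by (rule LIMSEQ_ignore_initial_segment)
  qed
  then show thesis by (rule that)
qed

text \<open>Equivalently, \<open>z\<close> lies in the closed convex hull of every tail of \<open>x\<close>. For the bounded
  sequence of interest this replaces weak cluster points, and with them weak compactness.\<close>

definition asymptotic_hull :: "(nat \<Rightarrow> 'a::real_inner) \<Rightarrow> 'a set"
  where "asymptotic_hull x =
    {z. \<forall>d R. (\<forall>\<^sub>F k in sequentially. R \<le> inner d (x k)) \<longrightarrow> R \<le> inner d z}"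

lemma asymptotic_hullD:
  assumes "z \<in> asymptotic_hull x" "\<forall>\<^sub>F k in sequentially. R \<le> inner d (x k)"
  shows "R \<le> inner d z"
  using assms by (auto simp: asymptotic_hull_def)

lemma asymptotic_hull_tendsto_le:
  assumes z: "z \<in> asymptotic_hull x" and "g \<longlonglongrightarrow> L"
    and ev: "\<forall>\<^sub>F k in sequentially. g k \<le> inner d (x k)"
  shows "L \<le> inner d z"
proof (rule field_le_epsilon)
  fix e :: real
  assume "e > 0"
  then have "\<forall>\<^sub>F k in sequentially. L - e < g k"
    by (intro order_tendstoD(1)[OF \<open>g \<longlonglongrightarrow> L\<close>]) simp
  with ev have "\<forall>\<^sub>F k in sequentially. L - e \<le> inner d (x k)"
    by eventually_elim simp
  from asymptotic_hullD[OF z this] show "L \<le> inner d z + e" by simp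
qed

lemma asymptotic_hull_tendsto:
  assumes z: "z \<in> asymptotic_hull x" and L: "(\<lambda>k. inner d (x k)) \<longlonglongrightarrow> L"
  shows "inner d z = L"
proof (rule antisym)
  show "L \<le> inner d z" by (rule asymptotic_hull_tendsto_le[OF z L]) simp
  have "- L \<le> inner (- d) z"
    by (rule asymptotic_hull_tendsto_le[OF z tendsto_minus[OF L]]) simp
  then show "inner d z \<le> L" by simp
qed

text \<open>The convergent part \<open>inner d (s k)\<close> is moved into the lower bound. The sign
  of \<open>c\<close> is free since \<open>c\<close> is absorbed into the direction
  \<open>d\<close>.\<close>

lemma asymptotic_hull_affine:
  assumes z: "z \<in> asymptotic_hull x" and "s \<longlonglongrightarrow> s0"
  shows "c *\<^sub>R z + s0 \<in> asymptotic_hull (\<lambda>k. c *\<^sub>R x k + s k)"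
  unfolding asymptotic_hull_def
proof (intro CollectI allI impI)
  fix d R
  assume "\<forall>\<^sub>F k in sequentially. R \<le> inner d (c *\<^sub>R x k + s k)"
  then have "\<forall>\<^sub>F k in sequentially. R - inner d (s k) \<le> inner (c *\<^sub>R d) (x k)"
    by eventually_elim (simp add: inner_add_right algebra_simps)
  moreover have "(\<lambda>k. R - inner d (s k)) \<longlonglongrightarrow> R - inner d s0"
    by (intro tendsto_intros assms)
  ultimately have "R - inner d s0 \<le> inner (c *\<^sub>R d) z"
    by (intro asymptotic_hull_tendsto_le[OF z])
  then show "R \<le> inner d (c *\<^sub>R z + s0)" by (simp add: inner_add_right)
qed

lemma asymptotic_hull_subseq:
  assumes "strict_mono r" shows "asymptotic_hull (x \<circ> r) \<subseteq> asymptotic_hull x"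
  using eventually_subseq[OF assms] by (fastforce simp: asymptotic_hull_def)

text \<open>The closed convex hulls of the tails are nested and bounded, so they share a point; a
  closed halfspace containing a tail contains its closed convex hull.\<close>

lemma asymptotic_hull_nonempty:
  fixes x :: "nat \<Rightarrow> 'a::{real_inner, complete_space}"
  assumes "bounded (range x)"
  shows "asymptotic_hull x \<noteq> {}"
proof -
  define C where "C n = closure (convex hull (x ` {n..}))" for n
  have "decseq C"
    unfolding C_def by (intro decseq_SucI closure_mono hull_mono image_mono) auto
  moreover have "bounded (C 0)"
    unfolding C_def by (intro bounded_closure bounded_convex_hull bounded_subset[OF assms]) auto
  moreover have "closed (C n)" "convex (C n)" "C n \<noteq> {}" for n
    by (simp_all add: C_def convex_closure)
  ultimately obtain z where z: "\<And>n. z \<in> C n"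
    using nested_convex_Inter_nonempty[of C] by metis
  have "z \<in> asymptotic_hull x"
    unfolding asymptotic_hull_def
  proof (intro CollectI allI impI)
    fix d R
    assume "\<forall>\<^sub>F k in sequentially. R \<le> inner d (x k)"
    then obtain N where "x ` {N..} \<subseteq> {y. R \<le> inner d y}"
      by (auto simp: eventually_sequentially)
    then have "C N \<subseteq> {y. R \<le> inner d y}"
      unfolding C_def
      using closed_halfspace_ge[of R d] convex_halfspace_ge[of R d]
      by (intro closure_minimal hull_minimal) simp_all
    then show "R \<le> inner d z" using z[of N] by blast
  qed
  then show ?thesis by blast
qed

text \<open>Opial's argument: the Fejer property lets \<open>asymptotic_hull x\<close> have only one point.\<close>

lemma weakly_tendsto_Fejer:
  fixes x :: "nat \<Rightarrow> 'a::{real_inner, complete_space}"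
  assumes "bounded (range x)"
    and conv: "\<And>f. f \<in> F \<Longrightarrow> convergent (\<lambda>k. (norm (x k - f))\<^sup>2)"
    and hull: "asymptotic_hull x \<subseteq> F"
  obtains z where "z \<in> F" "weakly_tendsto x z"
proof -
  obtain z where z: "z \<in> asymptotic_hull x"
    using asymptotic_hull_nonempty[OF assms(1)] by blast
  have unique: "z' = z" if z': "z' \<in> asymptotic_hull x" for z'
  proof -
    have "convergent (\<lambda>k. (norm (x k - z'))\<^sup>2 - (norm (x k - z))\<^sup>2)"
      using z z' hull by (intro convergent_diff conv) auto
    then obtain L where "(\<lambda>k. (norm (x k - z'))\<^sup>2 - (norm (x k - z))\<^sup>2) \<longlonglongrightarrow> L"
      by (auto simp: convergent_def)
    \<comment> \<open>The difference of the two squared distances is affine in \<open>x k\<close>,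
      so \<open>inner (z' - z) (x k)\<close> converges. Both hull points must attain its
      limit.\<close>
    then have "(\<lambda>k. ((norm z')\<^sup>2 - (norm z)\<^sup>2
        - ((norm (x k - z'))\<^sup>2 - (norm (x k - z))\<^sup>2)) / 2)
      \<longlonglongrightarrow> ((norm z')\<^sup>2 - (norm z)\<^sup>2 - L) / 2"
      by (intro tendsto_intros) simp_all
    moreover have "((norm z')\<^sup>2 - (norm z)\<^sup>2
        - ((norm (x k - z'))\<^sup>2 - (norm (x k - z))\<^sup>2)) / 2 = inner (z' - z) (x k)" for k
      unfolding power2_norm_eq_inner by (simp add: inner_simps inner_commute)
    ultimately have "(\<lambda>k. inner (z' - z) (x k)) \<longlonglongrightarrow> ((norm z')\<^sup>2 - (norm z)\<^sup>2 - L) / 2"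
      by simp
    then have "inner (z' - z) z' = inner (z' - z) z"
      using asymptotic_hull_tendsto z z' by metis
    then have "inner (z' - z) (z' - z) = 0" by (simp add: inner_diff_right)
    then show ?thesis by simp
  qed
  \<comment> \<open>If this fails, a subsequence stays in the halfspace where
    \<open>R \<le> inner y\<close>. Its asymptotic hull is nonempty and can contain only
    \<open>z\<close>, which lies outside that halfspace.\<close>
  have upper: "\<forall>\<^sub>F k in sequentially. inner y (x k) < R" if "inner y z < R" for y R
  proof (rule ccontr)
    assume "\<not> ?thesis"
    then have "\<exists>\<^sub>F k in sequentially. R \<le> inner y (x k)"
      by (simp add: frequently_def not_le)
    then have inf: "infinite {k. R \<le> inner y (x k)}"
      by (simp add: frequently_cofinite flip: cofinite_eq_sequentially)
    define r where "r = enumerate {k. R \<le> inner y (x k)}"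
    have "strict_mono r" unfolding r_def by (rule strict_mono_enumerate[OF inf])
    have r: "R \<le> inner y ((x \<circ> r) k)" for k
      using enumerate_in_set[OF inf] by (simp add: r_def)
    have "bounded (range (x \<circ> r))"
      using assms(1) by (rule bounded_subset) auto
    then obtain z' where z': "z' \<in> asymptotic_hull (x \<circ> r)"
      using asymptotic_hull_nonempty by blast
    then have "z' = z" using unique asymptotic_hull_subseq[OF \<open>strict_mono r\<close>] by blast
    moreover have "R \<le> inner y z'" using r by (intro asymptotic_hullD[OF z']) simp
    ultimately show False using that by simp
  qed
  have "weakly_tendsto x z"
    unfolding weakly_tendsto_def
  proof (intro allI order_tendstoI)
    fix y R
    show "\<forall>\<^sub>F k in sequentially. inner (x k) y < R" if "inner z y < R"
      using upper[of y R] that by (simp add: inner_commute)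
    show "\<forall>\<^sub>F k in sequentially. R < inner (x k) y" if "R < inner z y"
      using upper[of "- y" "- R"] that by (simp add: inner_commute)
  qed
  with z hull show thesis using that by blast
qed

section \<open>Convergence of the Douglas-Rachford iteration\<close>

text \<open>Strong-weak closedness of the graph, with hull points in place of weak limits. Since
  \<open>c\<close> is bounded and \<open>s\<close> tends to \<open>p\<close>, replacing
  \<open>s k\<close> by \<open>p\<close> in the pairing with \<open>c k\<close> costs a null
  sequence; what remains is a lower bound on the linear expression
  \<open>inner (p - y) (c k)\<close>, which passes to \<open>z\<close>.\<close>

lemma max_monotone_mod_closed:
  assumes max: "max_monotone_mod \<alpha> A" and mem: "\<And>k. c k \<in> A (s k)"
    and s: "s \<longlonglongrightarrow> p" and c: "bounded (range c)" "z \<in> asymptotic_hull c"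
  shows "z \<in> A p"
proof (rule max_monotone_mod_memI[OF max])
  fix y v
  assume "v \<in> A y"
  obtain M where M: "\<And>k. norm (c k) \<le> M" using c(1) by (auto simp: bounded_iff)
  have "(\<lambda>k. inner (s k - p) (c k)) \<longlonglongrightarrow> 0"
  proof (rule Lim_null_comparison)
    show "\<forall>\<^sub>F k in sequentially. norm (inner (s k - p) (c k)) \<le> norm (s k - p) * M"
      using M by (intro always_eventually allI)
        (metis Cauchy_Schwarz_ineq2 mult_left_mono norm_ge_zero order_trans real_norm_def)
    have "(\<lambda>k. norm (s k - p) * M) \<longlonglongrightarrow> norm (p - p) * M" by (intro tendsto_intros s)
    then show "(\<lambda>k. norm (s k - p) * M) \<longlonglongrightarrow> 0" by simp
  qed
  then have "(\<lambda>k. \<alpha> * (norm (s k - y))\<^sup>2 + inner (s k - y) v - inner (s k - p) (c k))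
      \<longlonglongrightarrow> \<alpha> * (norm (p - y))\<^sup>2 + inner (p - y) v - 0"
    by (intro tendsto_intros s)
  then have "\<alpha> * (norm (p - y))\<^sup>2 + inner (p - y) v - 0 \<le> inner (p - y) z"
  proof (rule asymptotic_hull_tendsto_le[OF c(2)])
    have "\<alpha> * (norm (s k - y))\<^sup>2 \<le> inner (s k - y) (c k - v)" for k
      using max mem[of k] \<open>v \<in> A y\<close> monotone_modD unfolding max_monotone_mod_def by blast
    then show "\<forall>\<^sub>F k in sequentially. \<alpha> * (norm (s k - y))\<^sup>2 + inner (s k - y) v
        - inner (s k - p) (c k) \<le> inner (p - y) (c k)"
      by (simp add: inner_diff_left inner_diff_right algebra_simps)
  qed
  then show "\<alpha> * (norm (p - y))\<^sup>2 \<le> inner (p - y) (z - v)"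
    by (simp add: inner_diff_right)
qed

lemma Douglas_Rachford_step:
  assumes "monotone_mod \<mu> A" "monotone_mod \<nu> B" "\<gamma> > 0" "0 < lam" "lam \<le> 2"
    and "u \<in> resolvent \<gamma> A x" "v \<in> resolvent \<gamma> B (2 *\<^sub>R u - x)"
    and "p \<in> resolvent \<gamma> A f" "p \<in> resolvent \<gamma> B (2 *\<^sub>R p - f)"
  shows "(norm (x + lam *\<^sub>R (v - u) - f))\<^sup>2
      + 2 * lam * \<gamma> * (\<mu> * (norm (u - p))\<^sup>2 + \<nu> * (norm (v - p))\<^sup>2) \<le> (norm (x - f))\<^sup>2"
proof -
  let ?I = "inner (u - p) ((x - u) - (f - p))"
  let ?J = "inner (v - p) ((2 *\<^sub>R u - x - v) - (2 *\<^sub>R p - f - p))"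
  have "(norm (x + lam *\<^sub>R (v - u) - f))\<^sup>2 = (norm (x - f))\<^sup>2
      + lam * (2 * inner (x - f) (v - u)) + lam * (lam * (norm (v - u))\<^sup>2)"
    unfolding power2_norm_eq_inner by (simp add: inner_simps inner_commute algebra_simps)
  \<comment> \<open>Here \<open>lam \<le> 2\<close> replaces the quadratic term by one linear in
    \<open>lam\<close>, so that the next identity can cancel the cross term.\<close>
  also have "\<dots> \<le> (norm (x - f))\<^sup>2 + lam * (2 * inner (x - f) (v - u)) + lam * (2 * (norm (v - u))\<^sup>2)"
    using assms(4,5) by (intro add_mono mult_left_mono mult_right_mono) auto
  \<comment> \<open>\<open>?I\<close> and \<open>?J\<close> are the monotonicity pairings of the two
    resolvents. Their sum is
    \<open>- inner (x - f) (v - u) - (norm (v - u))\<^sup>2\<close>.\<close>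
  also have "2 * (norm (v - u))\<^sup>2 = - 2 * inner (x - f) (v - u) - 2 * (?I + ?J)"
    unfolding power2_norm_eq_inner by (simp add: inner_simps inner_commute algebra_simps)
  also have "(norm (x - f))\<^sup>2 + lam * (2 * inner (x - f) (v - u))
      + lam * (- 2 * inner (x - f) (v - u) - 2 * (?I + ?J)) = (norm (x - f))\<^sup>2 - 2 * lam * (?I + ?J)"
    by (simp add: algebra_simps)
  finally have "(norm (x + lam *\<^sub>R (v - u) - f))\<^sup>2 + 2 * lam * (?I + ?J) \<le> (norm (x - f))\<^sup>2"
    by simp
  moreover have "2 * lam * (\<gamma> * \<mu> * (norm (u - p))\<^sup>2 + \<gamma> * \<nu> * (norm (v - p))\<^sup>2) \<le> 2 * lam * (?I + ?J)"
    using assms by (intro mult_left_mono add_mono resolvent_monotone) auto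
  ultimately show ?thesis by (simp add: distrib_left mult.assoc)
qed

lemma squared_distance_tendsto_zeroD:
  fixes s :: "nat \<Rightarrow> 'a::real_normed_vector"
  assumes "c > 0" and "\<And>k. c * (norm (s k - p))\<^sup>2 \<le> D k" and "D \<longlonglongrightarrow> 0"
  shows "s \<longlonglongrightarrow> p"
proof -
  have "(\<lambda>k. c * (norm (s k - p))\<^sup>2) \<longlonglongrightarrow> 0"
    by (rule tendsto_sandwich[OF _ _ tendsto_const assms(3)]) (use assms(1,2) in auto)
  then have "(\<lambda>k. sqrt (c * (norm (s k - p))\<^sup>2 / c)) \<longlonglongrightarrow> sqrt (0 / c)"
    using \<open>c > 0\<close> by (intro tendsto_intros) simp_all
  then have "(\<lambda>k. norm (s k - p)) \<longlonglongrightarrow> 0" using \<open>c > 0\<close> by simp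
  then show ?thesis by (rule LIM_zero_cancel[OF tendsto_norm_zero_cancel])
qed

theorem Douglas_Rachford_convergence:
  fixes A B :: "'a::{real_inner, complete_space} operator"
  assumes maxA: "max_monotone_mod \<mu> A" and maxB: "max_monotone_mod \<nu> B"
    and pos: "\<mu> > 0" "\<nu> > 0" "\<gamma> > 0" "0 < lam" "lam \<le> 2"
    and a: "a \<in> A p" "- a \<in> B p"
    and u: "\<And>k. u k \<in> resolvent \<gamma> A (x k)"
    and v: "\<And>k. v k \<in> resolvent \<gamma> B (2 *\<^sub>R u k - x k)"
    and x: "\<And>k. x (Suc k) = x k + lam *\<^sub>R (v k - u k)"
  obtains z where "u \<longlonglongrightarrow> p" "weakly_tendsto x z" "p \<in> resolvent \<gamma> A z"
proof -
  \<comment> \<open>At such an \<open>f\<close> both resolvent steps give \<open>p\<close>, so the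
    iteration does not move: these are fixed points with shadow \<open>p\<close>.\<close>
  define F where "F = {f. p \<in> resolvent \<gamma> A f \<and> p \<in> resolvent \<gamma> B (2 *\<^sub>R p - f)}"
  define D where "D f k = (norm (x k - f))\<^sup>2 - (norm (x (Suc k) - f))\<^sup>2" for f k
  have step: "2 * lam * \<gamma> * (\<mu> * (norm (u k - p))\<^sup>2 + \<nu> * (norm (v k - p))\<^sup>2) \<le> D f k"
    if "f \<in> F" for f k
    using Douglas_Rachford_step[of \<mu> A \<nu> B \<gamma> lam "u k" "x k" "v k" p f] that maxA maxB pos u v
    by (simp add: D_def x F_def max_monotone_mod_def)
  have dec: "decseq (\<lambda>k. (norm (x k - f))\<^sup>2)" if "f \<in> F" for f
  proof (rule decseq_SucI)
    fix k
    have "0 \<le> 2 * lam * \<gamma> * (\<mu> * (norm (u k - p))\<^sup>2 + \<nu> * (norm (v k - p))\<^sup>2)"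
      using pos by simp
    also note step[OF that]
    finally show "(norm (x (Suc k) - f))\<^sup>2 \<le> (norm (x k - f))\<^sup>2" by (simp add: D_def)
  qed
  have conv: "convergent (\<lambda>k. (norm (x k - f))\<^sup>2)" if f: "f \<in> F" for f
    using decseq_convergent[OF dec[OF f], of 0] by (auto simp: convergent_def)
  \<comment> \<open>The zero of the sum supplies a fixed point: \<open>f\<close> is
    \<open>p + \<gamma> a\<close>, and its reflection \<open>2 p - f\<close> is
    \<open>p + \<gamma> (- a)\<close> with \<open>- a\<close> in \<open>B p\<close>.\<close>
  define f where "f = p + \<gamma> *\<^sub>R a"
  have "f \<in> F"
    using a \<open>\<gamma> > 0\<close> by (simp add: F_def f_def mem_resolvent_iff scaleR_2)
  obtain L where L: "(\<lambda>k. (norm (x k - f))\<^sup>2) \<longlonglongrightarrow> L"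
    using conv[OF \<open>f \<in> F\<close>] by (auto simp: convergent_def)
  have "D f \<longlonglongrightarrow> L - L"
    unfolding D_def by (intro tendsto_diff L LIMSEQ_Suc[OF L])
  then have D: "D f \<longlonglongrightarrow> 0" by simp
  have split: "2 * lam * \<gamma> * \<mu> * (norm (u k - p))\<^sup>2 \<le> D f k"
    "2 * lam * \<gamma> * \<nu> * (norm (v k - p))\<^sup>2 \<le> D f k" for k
  proof -
    have "0 \<le> 2 * lam * \<gamma> * \<mu> * (norm (u k - p))\<^sup>2" "0 \<le> 2 * lam * \<gamma> * \<nu> * (norm (v k - p))\<^sup>2"
      using pos by simp_all
    moreover have "2 * lam * \<gamma> * \<mu> * (norm (u k - p))\<^sup>2 + 2 * lam * \<gamma> * \<nu> * (norm (v k - p))\<^sup>2 \<le> D f k"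
      using step[OF \<open>f \<in> F\<close>, of k] by (simp add: distrib_left mult.assoc)
    ultimately show "2 * lam * \<gamma> * \<mu> * (norm (u k - p))\<^sup>2 \<le> D f k"
      "2 * lam * \<gamma> * \<nu> * (norm (v k - p))\<^sup>2 \<le> D f k"
      by linarith+
  qed
  have u_lim: "u \<longlonglongrightarrow> p"
    by (rule squared_distance_tendsto_zeroD[OF _ split(1) D]) (use pos in simp)
  have v_lim: "v \<longlonglongrightarrow> p"
    by (rule squared_distance_tendsto_zeroD[OF _ split(2) D]) (use pos in simp)
  have "norm (x k - f) \<le> norm (x 0 - f)" for k
    using decseqD[OF dec[OF \<open>f \<in> F\<close>], of 0 k] by (simp add: power2_le_iff_abs_le)
  then have "range x \<subseteq> cball f (norm (x 0 - f))"
    by (auto simp: dist_norm norm_minus_commute)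
  then have bdd_x: "bounded (range x)" using bounded_cball bounded_subset by blast
  have bdd_u: "bounded (range u)" and bdd_v: "bounded (range v)"
    using u_lim v_lim convergent_imp_bounded by (auto simp: convergent_def)
  \<comment> \<open>The operator values certified by the resolvent steps, written as a multiple of
    \<open>x k\<close> plus a convergent sequence to suit \<open>asymptotic_hull_affine\<close>.
    Their candidate limits in \<open>A p\<close> and \<open>B p\<close> are exactly the two
    memberships that define \<open>F\<close>.\<close>
  define \<alpha> where "\<alpha> = (\<lambda>k. (1 / \<gamma>) *\<^sub>R x k + (- (1 / \<gamma>)) *\<^sub>R u k)"
  define \<beta> where "\<beta> = (\<lambda>k. (- (1 / \<gamma>)) *\<^sub>R x k + (1 / \<gamma>) *\<^sub>R (2 *\<^sub>R u k - v k))"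
  have \<alpha>: "\<alpha> k \<in> A (u k)" and \<beta>: "\<beta> k \<in> B (v k)" for k
    using u[of k] v[of k] \<open>\<gamma> > 0\<close>
    by (simp_all add: mem_resolvent_iff \<alpha>_def \<beta>_def scaleR_diff_right algebra_simps)
  have bdd: "bounded (range \<alpha>)" "bounded (range \<beta>)"
    unfolding \<alpha>_def \<beta>_def
    by (intro bounded_plus_comp bounded_minus_comp bounded_scaleR_comp bdd_x bdd_u bdd_v)+
  have hull: "asymptotic_hull x \<subseteq> F"
  proof
    fix z
    assume z: "z \<in> asymptotic_hull x"
    have "(1 / \<gamma>) *\<^sub>R z + (- (1 / \<gamma>)) *\<^sub>R p \<in> A p"
    proof (rule max_monotone_mod_closed[OF maxA \<alpha> u_lim bdd(1)])
      show "(1 / \<gamma>) *\<^sub>R z + (- (1 / \<gamma>)) *\<^sub>R p \<in> asymptotic_hull \<alpha>"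
        unfolding \<alpha>_def by (intro asymptotic_hull_affine[OF z] tendsto_intros u_lim)
    qed
    moreover have "(- (1 / \<gamma>)) *\<^sub>R z + (1 / \<gamma>) *\<^sub>R (2 *\<^sub>R p - p) \<in> B p"
    proof (rule max_monotone_mod_closed[OF maxB \<beta> v_lim bdd(2)])
      show "(- (1 / \<gamma>)) *\<^sub>R z + (1 / \<gamma>) *\<^sub>R (2 *\<^sub>R p - p) \<in> asymptotic_hull \<beta>"
        unfolding \<beta>_def by (intro asymptotic_hull_affine[OF z] tendsto_intros u_lim v_lim)
    qed
    ultimately show "z \<in> F"
      using \<open>\<gamma> > 0\<close> by (simp add: F_def mem_resolvent_iff algebra_simps scaleR_2)
  qed
  obtain z where "z \<in> F" "weakly_tendsto x z"
    using weakly_tendsto_Fejer[OF bdd_x conv hull] by blast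
  then show thesis using that u_lim by (auto simp: F_def)
qed

section \<open>Reduction to strongly monotone operators\<close>

theorem theorem6:
  fixes A B :: "'a::{real_inner, complete_space} operator"
    and \<alpha>\<^sub>A \<alpha>\<^sub>B \<theta> \<sigma>\<^sub>A \<sigma>\<^sub>B \<gamma> lam :: real
    and q x0 :: 'a
    and x u v :: "nat \<Rightarrow> 'a"
  assumes "max_monotone_mod \<alpha>\<^sub>A A" and "max_monotone_mod \<alpha>\<^sub>B B"
    and "\<theta> > 0" and "\<sigma>\<^sub>A > 0" and "\<sigma>\<^sub>B > 0"
    and "\<theta> * \<alpha>\<^sub>A + \<sigma>\<^sub>A > 0" and "\<theta> * \<alpha>\<^sub>B + \<sigma>\<^sub>B > 0"
    and "\<gamma> > 0"
    and "lam \<in> {0<..2}"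
    and "q \<in> op_ran (op_add op_Id (op_scale (\<theta> / (\<sigma>\<^sub>A + \<sigma>\<^sub>B)) (op_add A B)))"
    and "x 0 = x0"
    and "\<And>k. u k = the_elem (resolvent (\<gamma> * \<theta> / (1 + \<gamma> * \<sigma>\<^sub>A)) A
           ((1 / (1 + \<gamma> * \<sigma>\<^sub>A)) *\<^sub>R (x k + (\<gamma> * \<sigma>\<^sub>A) *\<^sub>R q)))"
    and "\<And>k. v k = the_elem (resolvent (\<gamma> * \<theta> / (1 + \<gamma> * \<sigma>\<^sub>B)) B
           ((1 / (1 + \<gamma> * \<sigma>\<^sub>B)) *\<^sub>R (2 *\<^sub>R u k - x k + (\<gamma> * \<sigma>\<^sub>B) *\<^sub>R q)))"
    and "\<And>k. x (Suc k) = x k + lam *\<^sub>R (v k - u k)"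
  shows "(\<forall>k. resolvent (\<gamma> * \<theta> / (1 + \<gamma> * \<sigma>\<^sub>A)) A
             ((1 / (1 + \<gamma> * \<sigma>\<^sub>A)) *\<^sub>R (x k + (\<gamma> * \<sigma>\<^sub>A) *\<^sub>R q)) = {u k}) \<and>
         (\<forall>k. resolvent (\<gamma> * \<theta> / (1 + \<gamma> * \<sigma>\<^sub>B)) B
             ((1 / (1 + \<gamma> * \<sigma>\<^sub>B)) *\<^sub>R (2 *\<^sub>R u k - x k + (\<gamma> * \<sigma>\<^sub>B) *\<^sub>R q)) = {v k}) \<and>
         (\<exists>p. resolvent (\<theta> / (\<sigma>\<^sub>A + \<sigma>\<^sub>B)) (op_add A B) q = {p} \<and>
            u \<longlonglongrightarrow> p \<and>
            (\<exists>xs. weakly_tendsto x xs \<and>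
               resolvent (\<gamma> * \<theta> / (1 + \<gamma> * \<sigma>\<^sub>A)) A
                 ((1 / (1 + \<gamma> * \<sigma>\<^sub>A)) *\<^sub>R (xs + (\<gamma> * \<sigma>\<^sub>A) *\<^sub>R q)) = {p}))"
proof -
  define A' where "A' = op_affine \<theta> \<sigma>\<^sub>A (- \<sigma>\<^sub>A *\<^sub>R q) A"
  define B' where "B' = op_affine \<theta> \<sigma>\<^sub>B (- \<sigma>\<^sub>B *\<^sub>R q) B"
  define c where "c = \<theta> / (\<sigma>\<^sub>A + \<sigma>\<^sub>B)"
  have lam: "0 < lam" "lam \<le> 2" using assms(9) by auto
  have maxA': "max_monotone_mod (\<theta> * \<alpha>\<^sub>A + \<sigma>\<^sub>A) A'"
    unfolding A'_def using assms(1,3) by (rule max_monotone_mod_op_affine)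
  have maxB': "max_monotone_mod (\<theta> * \<alpha>\<^sub>B + \<sigma>\<^sub>B) B'"
    unfolding B'_def using assms(2,3) by (rule max_monotone_mod_op_affine)
  have resA: "resolvent (\<gamma> * \<theta> / (1 + \<gamma> * \<sigma>\<^sub>A)) A
      ((1 / (1 + \<gamma> * \<sigma>\<^sub>A)) *\<^sub>R (y + (\<gamma> * \<sigma>\<^sub>A) *\<^sub>R q)) = resolvent \<gamma> A' y" for y
    unfolding A'_def using assms(3,4,8) by (intro resolvent_op_affine[symmetric])
  have resB: "resolvent (\<gamma> * \<theta> / (1 + \<gamma> * \<sigma>\<^sub>B)) B
      ((1 / (1 + \<gamma> * \<sigma>\<^sub>B)) *\<^sub>R (y + (\<gamma> * \<sigma>\<^sub>B) *\<^sub>R q)) = resolvent \<gamma> B' y" for y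
    unfolding B'_def using assms(3,5,8) by (intro resolvent_op_affine[symmetric])
  have singleA: "\<exists>p. resolvent \<gamma> A' y = {p}" for y
    using resolvent_singleton[OF maxA', of \<gamma> y] assms(6,8) by (auto simp: add_pos_pos)
  have singleB: "\<exists>p. resolvent \<gamma> B' y = {p}" for y
    using resolvent_singleton[OF maxB', of \<gamma> y] assms(7,8) by (auto simp: add_pos_pos)
  \<comment> \<open>Single-valuedness ensures that \<open>the_elem\<close> returns a genuine
    resolvent value.\<close>
  have u: "resolvent \<gamma> A' (x k) = {u k}" for k
    using singleA[of "x k"] assms(12)[of k] unfolding resA by force
  have v: "resolvent \<gamma> B' (2 *\<^sub>R u k - x k) = {v k}" for k
    using singleB[of "2 *\<^sub>R u k - x k"] assms(13)[of k] unfolding resB by force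
  have "c > 0" using assms(3-5) by (simp add: c_def)
  obtain p where p: "p \<in> resolvent c (op_add A B) q"
    using assms(10) by (auto simp: op_ran_def resolvent_def op_inverse_def c_def)
  then obtain a b where ab: "a \<in> A p" "b \<in> B p" "q = p + c *\<^sub>R (a + b)"
    by (auto simp: mem_resolvent op_add_def set_plus_def)
  \<comment> \<open>The equation \<open>q = p + c (a + b)\<close>, cleared of its denominator, says
    that the elements of \<open>A' p\<close> and \<open>B' p\<close> built from \<open>a\<close> and
    \<open>b\<close> add up to 0.\<close>
  define a' where "a' = \<theta> *\<^sub>R a + \<sigma>\<^sub>A *\<^sub>R p + - \<sigma>\<^sub>A *\<^sub>R q"
  have "a' \<in> A' p" using ab(1) unfolding a'_def A'_def op_affine_def by blast
  have "(\<sigma>\<^sub>A + \<sigma>\<^sub>B) *\<^sub>R (q - p) = \<theta> *\<^sub>R (a + b)"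
    using assms(4,5) ab(3) by (simp add: c_def)
  then have "- a' = \<theta> *\<^sub>R b + \<sigma>\<^sub>B *\<^sub>R p + - \<sigma>\<^sub>B *\<^sub>R q"
    by (simp add: a'_def algebra_simps)
  then have "- a' \<in> B' p" using ab(2) unfolding B'_def op_affine_def by blast
  obtain z where z: "u \<longlonglongrightarrow> p" "weakly_tendsto x z" "p \<in> resolvent \<gamma> A' z"
    using Douglas_Rachford_convergence[OF maxA' maxB' assms(6,7,8) lam
        \<open>a' \<in> A' p\<close> \<open>- a' \<in> B' p\<close>, of u x v] u v assms(14) by blast
  have "resolvent \<gamma> A' z = {p}" using z(3) singleA[of z] by auto
  moreover have "resolvent c (op_add A B) q = {p}"
  proof -
    have mono: "monotone_mod (\<alpha>\<^sub>A + \<alpha>\<^sub>B) (op_add A B)"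
      using assms(1,2) unfolding max_monotone_mod_def by (blast intro: monotone_mod_op_add)
    \<comment> \<open>The two positive moduli of \<open>A'\<close> and \<open>B'\<close> together
      give the uniqueness condition for the resolvent of \<open>A + B\<close>.\<close>
    have "0 < (\<theta> * \<alpha>\<^sub>A + \<sigma>\<^sub>A + (\<theta> * \<alpha>\<^sub>B + \<sigma>\<^sub>B)) / (\<sigma>\<^sub>A + \<sigma>\<^sub>B)"
      using assms(4-7) by (simp add: add_pos_pos)
    also have "\<dots> = 1 + c * (\<alpha>\<^sub>A + \<alpha>\<^sub>B)"
      using assms(4,5) by (simp add: c_def field_simps)
    finally show ?thesis using resolvent_unique[OF mono \<open>c > 0\<close>] p by blast
  qed
  ultimately show ?thesis
    unfolding resA resB using u v z(1,2) by (auto simp: c_def)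
qed

end
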